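(* Let $\mathbb{K}$ be a finite commutative ring. Let $\mathbb{L}$ be a commutative $\mathbb{K}$-algebra. Let $n\in\mathbb{N}$. Let $A$ and $B$ be two $n\times n$-matrices over $\mathbb{L}$ such that $\chi_A=\chi_B$. Then the set $\{A^0,A^1,A^2,\ldots\}$ is finite if and only if the set $\{B^0,B^1,B^2,\ldots\}$ is finite.
   Context: $\mathbb{N}=\{0,1,2,\ldots\}$. Rings and algebras are associative and unital. For an $n\times n$-matrix $A$ over a commutative ring $\mathbb{L}$, the characteristic polynomial is $\chi_A=\det(tI_n-A)\in\mathbb{L}[t]$, where $I_n$ is the $n\times n$ identity matrix and $tI_n-A$ is viewed as a matrix over $\mathbb{L}[t]$. *)

theory Defs
  imports
    "HOL-Algebra.UnivPoly"
    "HOL-Combinatorics.Permutations"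
    "Jordan_Normal_Form.Matrix"
begin

text \<open>
  The matrix operations, determinant and characteristic polynomial of \<^theory>\<open>Jordan_Normal_Form.Matrix\<close>
  and its relatives are tied to type classes, in which \<open>0 \<noteq> 1\<close>.  Here the ground ring is an arbitrary
  commutative ring in the sense of \<^locale>\<open>cring\<close> (the zero ring is allowed), so the type
  \<^type>\<open>mat\<close> serves only as a container and the operations are taken from the ring \<open>R\<close>.
\<close>

definition matrix_ring :: "('a, 'm) ring_scheme \<Rightarrow> nat \<Rightarrow> 'a mat ring" where
  "matrix_ring R n = \<lparr>
     carrier = {A \<in> carrier_mat n n. elements_mat A \<subseteq> carrier R},
     monoid.mult = (\<lambda>A B. mat n n (\<lambda>(i, j). \<Oplus>\<^bsub>R\<^esub>k\<in>{..<n}. A $$ (i, k) \<otimes>\<^bsub>R\<^esub> B $$ (k, j))),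
     one = mat n n (\<lambda>(i, j). if i = j then \<one>\<^bsub>R\<^esub> else \<zero>\<^bsub>R\<^esub>),
     zero = mat n n (\<lambda>(i, j). \<zero>\<^bsub>R\<^esub>),
     add = (\<lambda>A B. mat n n (\<lambda>(i, j). A $$ (i, j) \<oplus>\<^bsub>R\<^esub> B $$ (i, j)))\<rparr>"

definition determinant :: "('a, 'm) ring_scheme \<Rightarrow> nat \<Rightarrow> 'a mat \<Rightarrow> 'a" where
  "determinant R n A =
     (\<Oplus>\<^bsub>R\<^esub>p\<in>{p. p permutes {..<n}}.
        (if evenperm p then \<one>\<^bsub>R\<^esub> else \<ominus>\<^bsub>R\<^esub> \<one>\<^bsub>R\<^esub>) \<otimes>\<^bsub>R\<^esub> (\<Otimes>\<^bsub>R\<^esub>i\<in>{..<n}. A $$ (i, p i)))"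

text \<open>In \<^term>\<open>UP R\<close>, \<open>monom (UP R) \<one> 1\<close> is the indeterminate \<open>t\<close> and \<open>monom (UP R) a 0\<close> the
  constant polynomial \<open>a\<close>; the matrix below is therefore \<open>t I\<^sub>n - A\<close> over \<open>R[t]\<close>.\<close>

definition characteristic_poly :: "('a, 'm) ring_scheme \<Rightarrow> nat \<Rightarrow> 'a mat \<Rightarrow> nat \<Rightarrow> 'a" where
  "characteristic_poly R n A =
     determinant (UP R) n
       (mat n n (\<lambda>(i, j).
          (if i = j then up_ring.monom (UP R) \<one>\<^bsub>R\<^esub> 1 else \<zero>\<^bsub>UP R\<^esub>)
            \<ominus>\<^bsub>UP R\<^esub> up_ring.monom (UP R) (A $$ (i, j)) 0))"

end

theory Submission
  imports Defs "Jordan_Normal_Form.Char_Poly" "HOL-Library.Poly_Mapping"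
begin

text \<open>
  Since \<open>K\<close> is finite, some \<open>m > 0\<close> vanishes in \<open>L\<close>. Suppose that \<open>A\<close> has finitely many powers and let
  \<open>p\<close> be a prime. Modulo \<open>p\<close>, Frobenius gives
  \<open>\<chi>\<^sub>A(t)\<^sup>p = det ((t - A)\<^sup>p) = det (t\<^sup>p - A\<^sup>p)\<close>, so the coefficients of the characteristic polynomial
  of the \<open>p\<^sup>i\<close>-th power of \<open>A\<close> are the \<open>p\<^sup>i\<close>-th powers of those of \<open>\<chi>\<^sub>A\<close>. Two of the powers of \<open>A\<close>
  with such exponents coincide, hence each coefficient of \<open>\<chi>\<^sub>A\<close> is a root modulo \<open>p\<close> of some
  \<open>x\<^bsup>p^j\<^esup> - x\<^bsup>p^i\<^esup>\<close> with \<open>i < j\<close>. Multiplying such polynomials over the prime factors of \<open>m\<close>, each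
  coefficient is a root of a monic integer polynomial, so the coefficients lie in a finite subring
  \<open>S\<close> of \<open>L\<close>. By Cayley--Hamilton the powers of \<open>B\<close> satisfy a linear recurrence with coefficients
  in \<open>S\<close>, so there are only finitely many of them.
\<close>

section \<open>Matrix powers, determinants and entrywise homomorphisms\<close>

lemma index_mult_mat_sum:
  assumes "A \<in> carrier_mat n n" "B \<in> carrier_mat n n" "i < n" "j < n"
  shows "(A * B) $$ (i, j) = (\<Sum>k<n. A $$ (i, k) * B $$ (k, j))"
  using assms by (auto simp: scalar_prod_def lessThan_atLeast0 intro!: sum.cong)

lemma pow_mat_add:
  fixes A :: "'a::comm_ring_1 mat"
  assumes "A \<in> carrier_mat n n"
  shows "A ^\<^sub>m (k + l) = A ^\<^sub>m k * A ^\<^sub>m l"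
proof (induction l)
  case 0
  then show ?case using assms by (metis add_0_right carrier_matD(1) pow_carrier_mat pow_mat.simps(1) right_mult_one_mat)
next
  case (Suc l)
  then show ?case using assms by (auto intro: assoc_mult_mat[of _ n n _ n _ n])
qed

lemma pow_mat_mult:
  fixes A :: "'a::comm_ring_1 mat"
  assumes "A \<in> carrier_mat n n"
  shows "A ^\<^sub>m (k * l) = (A ^\<^sub>m k) ^\<^sub>m l"
  using assms by (induction l) (auto simp: pow_mat_add add.commute[of k])

lemma det_pow_mat:
  fixes A :: "'a::comm_ring_1 mat"
  assumes "A \<in> carrier_mat n n"
  shows "det (A ^\<^sub>m k) = det A ^ k"
  using assms by (induction k) (auto simp: det_mult[of _ n] mult.commute)

lemma index_char_poly_matrix:
  assumes "A \<in> carrier_mat n n" "i < n" "j < n"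
  shows "char_poly_matrix A $$ (i, j) = (if i = j then [:0, 1:] else 0) - [:A $$ (i, j):]"
  using assms by (auto simp: char_poly_matrix_def)

lemma map_mat_pow_mat:
  assumes "comm_ring_hom f" "A \<in> carrier_mat n n"
  shows "map_mat f (A ^\<^sub>m k) = map_mat f A ^\<^sub>m k"
proof -
  interpret comm_ring_hom f by fact
  show ?thesis using assms(2)
    by (induction k) (auto simp: mat_hom_one mat_hom_mult[of _ n n _ n])
qed

section \<open>Cayley--Hamilton\<close>

text \<open>Comparing the coefficients of \<open>t^r\<close> in
  \<open>adj(t - A) (t - A) = chi_A(t) I\<close> and multiplying on the right by
  \<open>A^(k+r)\<close> gives a telescoping sum. The factor \<open>A^k\<close> yields a scalar
  linear recurrence for each fixed entry of the powers.\<close>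

lemma cayley_hamilton_entry:
  fixes A :: "'a::comm_ring_1 mat"
  assumes A: "A \<in> carrier_mat n n" and ij: "i < n" "j < n"
  shows "(\<Sum>r\<le>n. coeff (char_poly A) r * (A ^\<^sub>m (k + r)) $$ (i, j)) = 0"
proof -
  define N where "N = adj_mat (char_poly_matrix A)"
  have N: "N \<in> carrier_mat n n" and NM: "N * char_poly_matrix A = char_poly A \<cdot>\<^sub>m 1\<^sub>m n"
    using adj_mat[of "char_poly_matrix A" n] A by (auto simp: N_def char_poly_def)
  have ent: "(if l = i then coeff (char_poly A) r else 0) =
      (if r = 0 then 0 else coeff (N $$ (i, l)) (r - 1)) - (\<Sum>c<n. coeff (N $$ (i, c)) r * A $$ (c, l))"
    if "l < n" for l r
  proof -
    have "(if l = i then char_poly A else 0) = (N * char_poly_matrix A) $$ (i, l)"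
      using ij that by (simp add: NM)
    also have "\<dots> = (\<Sum>c<n. N $$ (i, c) * char_poly_matrix A $$ (c, l))"
      using index_mult_mat_sum[OF N _ ij(1) that] A by simp
    also have "\<dots> = (\<Sum>c<n. (if c = l then pCons 0 (N $$ (i, c)) else 0) - smult (A $$ (c, l)) (N $$ (i, c)))"
      using that by (intro sum.cong refl) (auto simp: index_char_poly_matrix[OF A] algebra_simps)
    also have "\<dots> = pCons 0 (N $$ (i, l)) - (\<Sum>c<n. smult (A $$ (c, l)) (N $$ (i, c)))"
      using that by (simp add: sum_subtractf)
    finally have "coeff (if l = i then char_poly A else 0) r = coeff \<dots> r" by simp
    then show ?thesis
      by (auto simp: coeff_sum coeff_pCons mult.commute split: nat.splits if_splits)
  qed
  \<comment> \<open>\<open>y r\<close> is the entry of \<open>N\<^bsub>r-1\<^esub> A\<^bsup>k+r\<^esup>\<close>, where \<open>N\<^sub>r\<close> is the coefficient of \<open>t\<^sup>r\<close> in the adjugate \<open>N\<close>.\<close>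
  define y where "y r = (if r = 0 then 0 else \<Sum>l<n. coeff (N $$ (i, l)) (r - 1) * (A ^\<^sub>m (k + r)) $$ (l, j))" for r
  have tel: "coeff (char_poly A) r * (A ^\<^sub>m (k + r)) $$ (i, j) = y r - y (Suc r)" for r
  proof -
    have "coeff (char_poly A) r * (A ^\<^sub>m (k + r)) $$ (i, j) =
      (\<Sum>l<n. (if l = i then coeff (char_poly A) r else 0) * (A ^\<^sub>m (k + r)) $$ (l, j))"
      using ij by (simp add: if_distrib[of "\<lambda>x. x * _"] cong: if_cong)
    also have "\<dots> = (\<Sum>l<n. (if r = 0 then 0 else coeff (N $$ (i, l)) (r - 1)) * (A ^\<^sub>m (k + r)) $$ (l, j))
        - (\<Sum>l<n. \<Sum>c<n. coeff (N $$ (i, c)) r * (A $$ (c, l) * (A ^\<^sub>m (k + r)) $$ (l, j)))"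
      by (simp add: ent sum_subtractf algebra_simps sum_distrib_left)
    also have "(\<Sum>l<n. \<Sum>c<n. coeff (N $$ (i, c)) r * (A $$ (c, l) * (A ^\<^sub>m (k + r)) $$ (l, j)))
       = (\<Sum>c<n. coeff (N $$ (i, c)) r * (A * A ^\<^sub>m (k + r)) $$ (c, j))"
      by (subst sum.swap) (use A ij in \<open>auto simp: index_mult_mat_sum[of _ n] sum_distrib_left simp del: index_mult_mat(1) intro!: sum.cong\<close>)
    also have "A * A ^\<^sub>m (k + r) = A ^\<^sub>m (k + Suc r)"
      using pow_mat_add[OF A, of 1 "k + r"] A by simp
    finally show ?thesis by (simp add: y_def)
  qed
  \<comment> \<open>\<open>D >= n\<close>, so extending the sum to \<open>D\<close> adds only
    vanishing coefficients; \<open>D\<close> exceeds the degrees in row \<open>i\<close> of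
    \<open>N\<close>, so the end term \<open>y (Suc D)\<close>, which reads coefficient
    \<open>D\<close>, vanishes.\<close>
  define D where "D = Suc (n + (\<Sum>l<n. degree (N $$ (i, l))))"
  have "coeff (N $$ (i, l)) D = 0" if "l < n" for l
  proof -
    have "degree (N $$ (i, l)) \<le> (\<Sum>l<n. degree (N $$ (i, l)))"
      using that by (intro member_le_sum) auto
    then show ?thesis by (intro coeff_eq_0) (auto simp: D_def)
  qed
  then have yD: "y (Suc D) = 0" by (auto simp: y_def)
  have "(\<Sum>r\<le>n. coeff (char_poly A) r * (A ^\<^sub>m (k + r)) $$ (i, j)) =
     (\<Sum>r\<le>D. coeff (char_poly A) r * (A ^\<^sub>m (k + r)) $$ (i, j))"
    using degree_monic_char_poly[OF A]
    by (intro sum.mono_neutral_left) (auto simp: D_def coeff_eq_0)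
  also have "\<dots> = (\<Sum>r\<le>D. y r - y (Suc r))" by (simp only: tel)
  also have "\<dots> = y 0 - y (Suc D)" by (rule sum_telescope)
  also have "y 0 = 0" by (simp add: y_def)
  finally show ?thesis by (simp add: yD)
qed

section \<open>Congruences\<close>

text \<open>A congruence of a ring is represented by a map \<open>h\<close> whose fibres are its classes.\<close>

locale ring_congruence =
  fixes h :: "'a::comm_ring_1 \<Rightarrow> 'b"
  assumes add: "h x = h x' \<Longrightarrow> h y = h y' \<Longrightarrow> h (x + y) = h (x' + y')"
    and mult: "h x = h x' \<Longrightarrow> h y = h y' \<Longrightarrow> h (x * y) = h (x' * y')"
begin

lemma uminus: "h x = h x' \<Longrightarrow> h (- x) = h (- x')"
  using mult[of "- 1" "- 1" x x'] by simp

lemma diff: "h x = h x' \<Longrightarrow> h y = h y' \<Longrightarrow> h (x - y) = h (x' - y')"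
  using add[OF _ uminus, of x x' y y'] by simp

lemma eq_iff_diff: "h x = h y \<longleftrightarrow> h (x - y) = h 0"
  using diff[of x y y y] add[of "x - y" 0 y y] by auto

lemma sum: "(\<And>i. i \<in> I \<Longrightarrow> h (f i) = h (g i)) \<Longrightarrow> h (sum f I) = h (sum g I)"
  by (induction I rule: infinite_finite_induct) (auto intro: add)

lemma prod: "(\<And>i. i \<in> I \<Longrightarrow> h (f i) = h (g i)) \<Longrightarrow> h (prod f I) = h (prod g I)"
  by (induction I rule: infinite_finite_induct) (auto intro: mult)

lemma power: "h x = h y \<Longrightarrow> h (x ^ k) = h (y ^ k)"
  by (induction k) (auto intro: mult)

lemma det:
  assumes "A \<in> carrier_mat n n" "B \<in> carrier_mat n n"
    and "\<And>i j. i < n \<Longrightarrow> j < n \<Longrightarrow> h (A $$ (i, j)) = h (B $$ (i, j))"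
  shows "h (det A) = h (det B)"
  unfolding det_def'[OF assms(1)] det_def'[OF assms(2)]
  by (intro sum mult prod refl assms(3)) (auto simp: permutes_in_image)

text \<open>Coefficientwise congruence lets the lemma \<open>det\<close> be applied to the matrices
  \<open>t - A\<close> over the polynomial ring.\<close>

lemma ring_congruence_poly: "ring_congruence (\<lambda>p k. h (coeff p k))"
proof
  fix p p' q q' :: "'a poly"
  assume "(\<lambda>k. h (coeff p k)) = (\<lambda>k. h (coeff p' k))" "(\<lambda>k. h (coeff q k)) = (\<lambda>k. h (coeff q' k))"
  then have *: "h (coeff p k) = h (coeff p' k)" "h (coeff q k) = h (coeff q' k)" for k
    by meson+
  show "(\<lambda>k. h (coeff (p + q) k)) = (\<lambda>k. h (coeff (p' + q') k))"
    by (auto intro: add *)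
  show "(\<lambda>k. h (coeff (p * q) k)) = (\<lambda>k. h (coeff (p' * q') k))"
    by (auto simp: coeff_mult intro!: sum mult *)
qed

lemma char_poly:
  assumes "A \<in> carrier_mat n n" "B \<in> carrier_mat n n" "map_mat h A = map_mat h B"
  shows "h (coeff (char_poly A) k) = h (coeff (char_poly B) k)"
proof -
  interpret P: ring_congruence "\<lambda>p k. h (coeff p k)" by (rule ring_congruence_poly)
  have "h (A $$ (i, j)) = h (B $$ (i, j))" if "i < n" "j < n" for i j
    using assms that by (metis carrier_matD index_map_mat(1))
  then have "(\<lambda>k. h (coeff (char_poly A) k)) = (\<lambda>k. h (coeff (char_poly B) k))"
    unfolding char_poly_def using assms
    by (intro P.det[of _ n])
       (auto simp: index_char_poly_matrix coeff_pCons fun_eq_iff intro!: diff uminus split: nat.splits)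
  then show ?thesis by meson
qed

end

section \<open>Congruence modulo a principal ideal\<close>

lemma dvd_diff_class_eq_iff:
  fixes d :: "'a::comm_ring_1"
  shows "{z. d dvd x - z} = {z. d dvd y - z} \<longleftrightarrow> d dvd x - y"
proof
  assume "{z. d dvd x - z} = {z. d dvd y - z}"
  then have "y \<in> {z. d dvd x - z}" by auto
  then show "d dvd x - y" by simp
next
  assume *: "d dvd x - y"
  have "d dvd x - z \<longleftrightarrow> d dvd y - z" for z
    using dvd_add[OF *, of "y - z"] dvd_diff[OF _ *, of "x - z"] by auto
  then show "{z. d dvd x - z} = {z. d dvd y - z}" by blast
qed

lemma dvd_diff_trans:
  fixes d :: "'a::comm_ring_1"
  shows "d dvd x - y \<Longrightarrow> d dvd y - z \<Longrightarrow> d dvd x - z"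
  using dvd_add[of d "x - y" "y - z"] by simp

text \<open>With the coset of \<open>x\<close> as its value, the general results on congruences, in
  particular \<open>det\<close> and \<open>power\<close>, become available modulo a prime.\<close>

lemma ring_congruence_dvd: "ring_congruence (\<lambda>x::'a::comm_ring_1. {z. d dvd x - z})"
proof (unfold_locales, unfold dvd_diff_class_eq_iff)
  fix x x' y y' :: 'a assume *: "d dvd x - x'" "d dvd y - y'"
  show "d dvd x + y - (x' + y')" using dvd_add[OF *] by (simp add: algebra_simps)
  have "x * y - x' * y' = (x - x') * y + x' * (y - y')" by (simp add: algebra_simps)
  then show "d dvd x * y - x' * y'" using * by (metis dvd_add dvd_mult dvd_mult2)
qed

section \<open>The characteristic polynomial of a prime power\<close>

text \<open>The prime divides the binomial coefficients strictly between the two ends, so only the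
  extreme terms survive.\<close>

lemma prime_dvd_add_power:
  fixes x y :: "'a::comm_ring_1"
  assumes "prime p"
  shows "of_nat p dvd (x + y) ^ p - (x ^ p + y ^ p)"
proof -
  have p: "p > 0" "p \<noteq> 0" using assms by (auto simp: prime_gt_0_nat)
  have "(x + y) ^ p = (\<Sum>k\<le>p. of_nat (p choose k) * x ^ k * y ^ (p - k))"
    by (rule binomial_ring)
  also have "\<dots> = (\<Sum>k\<in>{0, p}. of_nat (p choose k) * x ^ k * y ^ (p - k))
      + (\<Sum>k\<in>{..p} - {0, p}. of_nat (p choose k) * x ^ k * y ^ (p - k))"
    by (subst add.commute, rule sum.subset_diff) auto
  also have "(\<Sum>k\<in>{0, p}. of_nat (p choose k) * x ^ k * y ^ (p - k)) = x ^ p + y ^ p"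
    using p by simp
  finally have "(x + y) ^ p - (x ^ p + y ^ p) =
      (\<Sum>k\<in>{..p} - {0, p}. of_nat (p choose k) * x ^ k * y ^ (p - k))" by simp
  also have "of_nat p dvd \<dots>"
  proof (intro dvd_sum dvd_mult2)
    fix k assume "k \<in> {..p} - {0, p}"
    then have "p dvd p choose k" using assms by (intro dvd_choose_prime) auto
    then show "of_nat p dvd (of_nat (p choose k) :: 'a)" by (auto simp: dvd_def)
  qed
  finally show ?thesis .
qed

lemma prime_dvd_sum_power:
  fixes f :: "'b \<Rightarrow> 'a::comm_ring_1"
  assumes "prime p"
  shows "of_nat p dvd (\<Sum>i\<in>I. f i) ^ p - (\<Sum>i\<in>I. f i ^ p)"
proof (induction I rule: infinite_finite_induct)
  case (insert i I)
  have "sum f (insert i I) ^ p - (\<Sum>i\<in>insert i I. f i ^ p) =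
     ((f i + sum f I) ^ p - (f i ^ p + sum f I ^ p)) + (sum f I ^ p - (\<Sum>i\<in>I. f i ^ p))"
    using insert by (simp add: algebra_simps)
  then show ?case using insert prime_dvd_add_power[OF assms] by (metis dvd_add)
qed (use assms in \<open>auto simp: zero_power prime_gt_0_nat\<close>)

lemma of_nat_dvd_coeff:
  assumes "of_nat d dvd (q :: 'a::comm_ring_1 poly)"
  shows "of_nat d dvd coeff q k"
proof -
  obtain r where "q = of_nat d * r" using assms by (auto simp: dvd_def)
  then show ?thesis by (simp add: of_nat_poly)
qed

text \<open>Frobenius is applied to \<open>q\<close> written as the sum of its monomials.\<close>

lemma prime_dvd_coeff_power:
  fixes q :: "'a::comm_ring_1 poly"
  assumes "prime p"
  shows "of_nat p dvd coeff (q ^ p) (k * p) - coeff q k ^ p"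
proof -
  have p: "p > 0" using assms by (auto simp: prime_gt_0_nat)
  have "of_nat p dvd (\<Sum>i\<le>degree q. Polynomial.monom (coeff q i) i) ^ p
      - (\<Sum>i\<le>degree q. Polynomial.monom (coeff q i) i ^ p)"
    by (rule prime_dvd_sum_power[OF assms])
  then have "of_nat p dvd coeff (q ^ p - (\<Sum>i\<le>degree q. Polynomial.monom (coeff q i ^ p) (i * p))) (k * p)"
    by (intro of_nat_dvd_coeff) (simp add: poly_as_sum_of_monoms monom_power mult.commute)
  also have "coeff (q ^ p - (\<Sum>i\<le>degree q. Polynomial.monom (coeff q i ^ p) (i * p))) (k * p)
      = coeff (q ^ p) (k * p) - (\<Sum>i\<le>degree q. if i = k then coeff q i ^ p else 0)"
    using p by (simp add: coeff_sum)
  \<comment> \<open>A \<open>k\<close> beyond the degree selects nothing on the left and gives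
    \<open>0 ^ p = 0\<close> on the right, by \<open>p > 0\<close>.\<close>
  also have "(\<Sum>i\<le>degree q. if i = k then coeff q i ^ p else 0) = coeff q k ^ p"
    using p by (auto simp: coeff_eq_0 zero_power not_le)
  finally show ?thesis .
qed

text \<open>The recurrence is that of the entries \<open>b k s\<close> of \<open>(X - A)\<^sup>k A\<^sup>s\<close>, so the conclusion
  is the binomial expansion of \<open>(X - A)\<^sup>k\<close>.\<close>

lemma iterate_diff_shift:
  fixes b :: "nat \<Rightarrow> nat \<Rightarrow> 'a::comm_ring_1"
  assumes "\<And>k s. b (Suc k) s = X * b k s - b k (Suc s)"
  shows "b k s = (\<Sum>r\<le>k. of_nat (k choose r) * (- 1) ^ r * X ^ (k - r) * b 0 (s + r))"
proof (induction k arbitrary: s)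
  case (Suc k)
  define g where "g k r = of_nat (k choose r) * (- 1) ^ r * X ^ (k - r) * b 0 (s + r)" for k r
  have 1: "X * b k s = (\<Sum>r\<le>k. X * g k r)"
    unfolding Suc g_def by (simp add: sum_distrib_left)
  have "X * g k r = of_nat (k choose r) * (- 1) ^ r * X ^ (Suc k - r) * b 0 (s + r)" if "r \<le> k" for r
    using that by (simp add: g_def Suc_diff_le algebra_simps)
  then have "X * b k s = (\<Sum>r\<le>Suc k. of_nat (k choose r) * (- 1) ^ r * X ^ (Suc k - r) * b 0 (s + r))"
    unfolding 1 by (simp add: binomial_eq_0)
  also have "\<dots> = X ^ Suc k * b 0 s
      - (\<Sum>r\<le>k. of_nat (k choose Suc r) * (- 1) ^ r * X ^ (k - r) * b 0 (s + Suc r))"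
    by (subst sum.atMost_Suc_shift) (simp add: sum_negf)
  finally have "b (Suc k) s = X ^ Suc k * b 0 s
      - (\<Sum>r\<le>k. of_nat (k choose Suc r) * (- 1) ^ r * X ^ (k - r) * b 0 (s + Suc r))
      - (\<Sum>r\<le>k. of_nat (k choose r) * (- 1) ^ r * X ^ (k - r) * b 0 (s + Suc r))"
    unfolding assms by (simp add: Suc[of "Suc s"])
  also have "\<dots> = (\<Sum>r\<le>Suc k. of_nat (Suc k choose r) * (- 1) ^ r * X ^ (Suc k - r) * b 0 (s + r))"
    by (subst sum.atMost_Suc_shift)
       (simp add: sum_negf sum.distrib sum_subtractf algebra_simps)
  finally show ?case .
qed simp

text \<open>Scalar form of \<open>(X - A)^p = X^p - A^p\<close> modulo \<open>p\<close>: the middle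
  binomial coefficients vanish, and the sign \<open>(-1)^p\<close> of the last term may be replaced
  by \<open>-1\<close>.\<close>

lemma prime_dvd_iterate_diff_shift:
  fixes b :: "nat \<Rightarrow> nat \<Rightarrow> 'a::comm_ring_1"
  assumes "prime p" "\<And>k s. b (Suc k) s = X * b k s - b k (Suc s)"
  shows "of_nat p dvd b p 0 - (X ^ p * b 0 0 - b 0 p)"
proof -
  have p: "p > 0" "p \<noteq> 0" using assms by (auto simp: prime_gt_0_nat)
  let ?f = "\<lambda>r. of_nat (p choose r) * (- 1) ^ r * X ^ (p - r) * b 0 r"
  have "b p 0 = (\<Sum>r\<le>p. ?f r)"
    using iterate_diff_shift[of b X p 0] assms(2) by simp
  also have "\<dots> = (\<Sum>r\<in>{0, p}. ?f r) + (\<Sum>r\<in>{..p} - {0, p}. ?f r)"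
    by (subst add.commute, rule sum.subset_diff) auto
  also have "(\<Sum>r\<in>{0, p}. ?f r) = X ^ p * b 0 0 + (- 1) ^ p * b 0 p"
    using p by simp
  finally have "b p 0 - (X ^ p * b 0 0 - b 0 p)
     = (1 + (- 1) ^ p) * b 0 p + (\<Sum>r\<in>{..p} - {0, p}. ?f r)" by (simp add: algebra_simps)
  moreover have "of_nat p dvd (\<Sum>r\<in>{..p} - {0, p}. ?f r)"
  proof (intro dvd_sum dvd_mult2)
    fix k assume "k \<in> {..p} - {0, p}"
    then have "p dvd p choose k" using assms by (intro dvd_choose_prime) auto
    then show "of_nat p dvd (of_nat (p choose k) :: 'a)" by (auto simp: dvd_def)
  qed
  \<comment> \<open>For odd \<open>p\<close> the sum is \<open>0\<close>, for \<open>p = 2\<close>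
    it is \<open>2\<close>.\<close>
  moreover have "of_nat p dvd (1 + (- 1) ^ p :: 'a)"
  proof (cases "p = 2")
    case False
    then have "odd p" using assms(1) prime_odd_nat[of p] prime_ge_2_nat[of p] by force
    then show ?thesis by simp
  qed auto
  ultimately show ?thesis by simp
qed

text \<open>Modulo \<open>p\<close>, \<open>\<chi>\<^sub>A(t)\<^sup>p = det ((t - A)\<^sup>p)\<close> agrees with \<open>det (t\<^sup>p - A\<^sup>p) = \<chi>(t\<^sup>p)\<close> for the
  characteristic polynomial \<open>\<chi>\<close> of \<open>A\<^sup>p\<close>; compare the coefficients of \<open>t\<^bsup>pk\<^esup>\<close>.\<close>

lemma prime_dvd_coeff_char_poly_pow:
  fixes A :: "'a::comm_ring_1 mat"
  assumes p: "prime p" and A: "A \<in> carrier_mat n n"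
  shows "of_nat p dvd coeff (char_poly (A ^\<^sub>m p)) k - coeff (char_poly A) k ^ p"
proof -
  have p0: "p > 0" using p by (auto simp: prime_gt_0_nat)
  let ?M = "char_poly_matrix A"
  let ?X = "Polynomial.monom 1 p :: 'a poly"
  define C where "C = map_mat (\<lambda>a. [:a:]) A"
  have hom: "comm_ring_hom (\<lambda>a::'a. [:a:])"
    by unfold_locales (auto simp: one_pCons)
  have C: "C \<in> carrier_mat n n" and M: "?M \<in> carrier_mat n n"
    using A by (auto simp: C_def)
  have Ck: "C ^\<^sub>m k = map_mat (\<lambda>a. [:a:]) (A ^\<^sub>m k)" for k
    unfolding C_def using map_mat_pow_mat[OF hom A] by simp
  \<comment> \<open>\<open>?T\<close> is \<open>t^p I - A^p\<close>, obtained by substituting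
    \<open>t^p\<close> for \<open>t\<close> in \<open>t I - A^p\<close>.\<close>
  let ?T = "map_mat (\<lambda>q. pcompose q ?X) (char_poly_matrix (A ^\<^sub>m p))"
  have entries: "of_nat p dvd (?M ^\<^sub>m p) $$ (i, j) - ?T $$ (i, j)" if ij: "i < n" "j < n" for i j
  proof -
    \<comment> \<open>The binomial expansion is carried out entry by entry: \<open>b p 0\<close> is
      the entry of \<open>(t - A)^p\<close>, while \<open>b 0 0\<close> and \<open>b 0 p\<close> are
      those of \<open>I\<close> and \<open>A^p\<close>.\<close>
    define b where "b k s = (?M ^\<^sub>m k * C ^\<^sub>m s) $$ (i, j)" for k s
    have "b (Suc k) s = [:0, 1:] * b k s - b k (Suc s)" for k s
    proof -
      have MC: "?M * C ^\<^sub>m s = [:0, 1:] \<cdot>\<^sub>m C ^\<^sub>m s - C ^\<^sub>m (Suc s)"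
      proof (rule eq_matI)
        fix a c assume "a < dim_row ([:0, 1:] \<cdot>\<^sub>m C ^\<^sub>m s - C ^\<^sub>m (Suc s))"
          "c < dim_col ([:0, 1:] \<cdot>\<^sub>m C ^\<^sub>m s - C ^\<^sub>m (Suc s))"
        then have ac: "a < n" "c < n" using C by auto
        have "(?M * C ^\<^sub>m s) $$ (a, c) =
            (\<Sum>l<n. (if l = a then [:0, 1:] * (C ^\<^sub>m s) $$ (l, c) else 0) - C $$ (a, l) * (C ^\<^sub>m s) $$ (l, c))"
          using ac by (subst index_mult_mat_sum[OF M])
            (use C A in \<open>auto simp: index_char_poly_matrix[OF A] C_def algebra_simps intro!: sum.cong\<close>)
        also have "\<dots> = [:0, 1:] * (C ^\<^sub>m s) $$ (a, c) - (C * C ^\<^sub>m s) $$ (a, c)"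
          using ac C by (simp add: sum_subtractf index_mult_mat_sum[OF C] del: index_mult_mat(1))
        also have "C * C ^\<^sub>m s = C ^\<^sub>m (Suc s)"
          using pow_mat_add[OF C, of 1 s] C by simp
        finally show "(?M * C ^\<^sub>m s) $$ (a, c) = ([:0, 1:] \<cdot>\<^sub>m C ^\<^sub>m s - C ^\<^sub>m (Suc s)) $$ (a, c)"
          using ac C by (simp del: pow_mat.simps)
      qed (use C M in auto)
      have "?M ^\<^sub>m Suc k * C ^\<^sub>m s = ?M ^\<^sub>m k * (?M * C ^\<^sub>m s)"
        using M C by (auto intro: assoc_mult_mat[of _ n n _ n _ n])
      also have "\<dots> = [:0, 1:] \<cdot>\<^sub>m (?M ^\<^sub>m k * C ^\<^sub>m s) - ?M ^\<^sub>m k * C ^\<^sub>m (Suc s)"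
        unfolding MC using M C
        by (subst mult_minus_distrib_mat[of _ n n _ n]) (auto simp: mult_smult_distrib[of _ n n _ n])
      finally show ?thesis using ij M C by (simp add: b_def del: pow_mat.simps)
    qed
    then have "of_nat p dvd b p 0 - ([:0, 1:] ^ p * b 0 0 - b 0 p)"
      using prime_dvd_iterate_diff_shift[OF p] by blast
    moreover have "b p 0 = (?M ^\<^sub>m p) $$ (i, j)" using M C by (simp add: b_def)
    moreover have "[:0, 1:] ^ p * b 0 0 - b 0 p = ?T $$ (i, j)"
    proof -
      have "b 0 s = [:(A ^\<^sub>m s) $$ (i, j):]" for s
        using ij A C M carrier_matD(1)[OF M] by (simp add: b_def Ck)
      then show ?thesis
        using ij A carrier_matD[OF char_poly_matrix_closed[OF pow_carrier_mat[OF A, of p]]]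
        by (auto simp: index_char_poly_matrix[of _ n] pcompose_diff pcompose_pCons monom_altdef)
    qed
    ultimately show ?thesis by simp
  qed
  interpret D: ring_congruence "\<lambda>x::'a poly. {z. of_nat p dvd x - z}"
    by (rule ring_congruence_dvd)
  have "of_nat p dvd det (?M ^\<^sub>m p) - det ?T"
    using D.det[of "?M ^\<^sub>m p" n ?T] M A entries unfolding dvd_diff_class_eq_iff by auto
  moreover have "det (?M ^\<^sub>m p) = char_poly A ^ p"
    using det_pow_mat[OF M] by (simp add: char_poly_def)
  moreover have "det ?T = pcompose (char_poly (A ^\<^sub>m p)) ?X"
  proof -
    have "comm_ring_hom (\<lambda>q. pcompose q ?X)"
      by unfold_locales (simp_all add: pcompose_add pcompose_mult pcompose_1)
    then show ?thesis unfolding char_poly_def by (rule comm_ring_hom.hom_det)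
  qed
  ultimately have "of_nat p dvd char_poly A ^ p - pcompose (char_poly (A ^\<^sub>m p)) ?X" by simp
  then have "of_nat p dvd coeff (char_poly A ^ p - pcompose (char_poly (A ^\<^sub>m p)) ?X) (k * p)"
    by (rule of_nat_dvd_coeff)
  then have "of_nat p dvd coeff (char_poly A ^ p) (k * p) - coeff (char_poly (A ^\<^sub>m p)) k"
    using p0 by (simp add: coeff_pcompose_x_pow_n mult.commute[of k])
  from dvd_diff[OF prime_dvd_coeff_power[OF p, of "char_poly A" k] this] show ?thesis by simp
qed

text \<open>The case of exponent \<open>p\<close> is applied to \<open>A^(p^i)\<close>, and the
  induction hypothesis is raised to the \<open>p\<close>-th power, which congruences
  respect.\<close>

lemma prime_dvd_coeff_char_poly_pow_power:
  fixes A :: "'a::comm_ring_1 mat"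
  assumes p: "prime p" and A: "A \<in> carrier_mat n n"
  shows "of_nat p dvd coeff (char_poly (A ^\<^sub>m (p ^ i))) k - coeff (char_poly A) k ^ (p ^ i)"
proof (induction i)
  case 0
  then show ?case using A by simp
next
  case (Suc i)
  interpret D: ring_congruence "\<lambda>x::'a. {z. of_nat p dvd x - z}"
    by (rule ring_congruence_dvd)
  have "of_nat p dvd coeff (char_poly ((A ^\<^sub>m (p ^ i)) ^\<^sub>m p)) k - coeff (char_poly (A ^\<^sub>m (p ^ i))) k ^ p"
    by (rule prime_dvd_coeff_char_poly_pow[OF p pow_carrier_mat[OF A]])
  moreover have "of_nat p dvd coeff (char_poly (A ^\<^sub>m (p ^ i))) k ^ p - (coeff (char_poly A) k ^ (p ^ i)) ^ p"
    using D.power Suc unfolding dvd_diff_class_eq_iff by blast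
  ultimately have "of_nat p dvd coeff (char_poly ((A ^\<^sub>m (p ^ i)) ^\<^sub>m p)) k - (coeff (char_poly A) k ^ (p ^ i)) ^ p"
    by (rule dvd_diff_trans)
  then show ?case unfolding power_Suc2 pow_mat_mult[OF A] power_mult .
qed

section \<open>Integrality over the integers modulo a congruence\<close>

locale unital_subring =
  fixes S :: "'a::comm_ring_1 set"
  assumes one: "1 \<in> S"
    and diff: "x \<in> S \<Longrightarrow> y \<in> S \<Longrightarrow> x - y \<in> S"
    and mult: "x \<in> S \<Longrightarrow> y \<in> S \<Longrightarrow> x * y \<in> S"
begin

lemma zero: "0 \<in> S"
  using diff[OF one one] by simp

lemma uminus: "x \<in> S \<Longrightarrow> - x \<in> S"
  using diff[OF zero, of x] by simp

lemma add: "x \<in> S \<Longrightarrow> y \<in> S \<Longrightarrow> x + y \<in> S"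
  using diff[OF _ uminus, of x y] by simp

lemma sum: "(\<And>i. i \<in> I \<Longrightarrow> f i \<in> S) \<Longrightarrow> sum f I \<in> S"
  by (induction I rule: infinite_finite_induct) (auto intro: zero add)

lemma coeff_mult: "(\<And>i. coeff p i \<in> S) \<Longrightarrow> (\<And>i. coeff q i \<in> S) \<Longrightarrow> coeff (p * q) i \<in> S"
  unfolding Polynomial.coeff_mult by (intro sum mult)

lemma evaluations: "unital_subring {poly p c | p. \<forall>i. coeff p i \<in> S}"
proof
  show "1 \<in> {poly p c | p. \<forall>i. coeff p i \<in> S}"
    by (auto simp: one zero intro!: exI[of _ 1])
next
  fix x y assume "x \<in> {poly p c | p. \<forall>i. coeff p i \<in> S}" "y \<in> {poly p c | p. \<forall>i. coeff p i \<in> S}"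
  then obtain p q where pq: "x = poly p c" "y = poly q c" "\<And>i. coeff p i \<in> S" "\<And>i. coeff q i \<in> S"
    by auto
  show "x - y \<in> {poly p c | p. \<forall>i. coeff p i \<in> S}"
    using pq by (auto intro!: exI[of _ "p - q"] diff)
  show "x * y \<in> {poly p c | p. \<forall>i. coeff p i \<in> S}"
    using pq by (auto intro!: exI[of _ "p * q"] coeff_mult)
qed

end

lemma unital_subring_Ints: "unital_subring (\<int> :: 'a::comm_ring_1 set)"
  by unfold_locales auto

text \<open>Zero divisors could lower the degree of a product, but here the candidate top
  coefficient is \<open>1\<close>, which is nonzero.\<close>

lemma monic_mult_comm_ring:
  fixes f g :: "'a::comm_ring_1 poly"
  assumes "lead_coeff f = 1" "lead_coeff g = 1"
  shows "lead_coeff (f * g) = 1"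
proof -
  have 1: "coeff (f * g) (degree f + degree g) = 1"
    using assms by (simp add: coeff_mult_degree_sum)
  then have "degree (f * g) = degree f + degree g"
    by (intro antisym degree_mult_le le_degree) simp
  with 1 show ?thesis by simp
qed

section \<open>Finiteness of recurrent sequences and integral extensions modulo a congruence\<close>

context ring_congruence
begin

text \<open>\<open>V\<close> is the \<open>S\<close>-span of the first \<open>d\<close> values. Up
  to congruence a combination depends only on the classes of its \<open>d\<close> coefficients, so
  \<open>V\<close> meets finitely many classes, and the recurrence keeps all later values congruent
  to elements of \<open>V\<close>. This serves both the powers of an integral element and the
  entries of matrix powers.\<close>

lemma recurrence_values:
  fixes d :: nat
  assumes "unital_subring S" and fin: "finite (h ` S)"
    and c: "\<And>i. i < d \<Longrightarrow> c i \<in> S"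
    and rec: "\<And>k. h (x (k + d)) = h (\<Sum>i<d. c i * x (k + i))"
  obtains V where "finite (h ` V)" "0 \<in> V" "\<And>u v. u \<in> V \<Longrightarrow> v \<in> V \<Longrightarrow> u + v \<in> V"
    "\<And>s v. s \<in> S \<Longrightarrow> v \<in> V \<Longrightarrow> s * v \<in> V" "\<And>k. h (x k) \<in> h ` V"
proof -
  interpret S: unital_subring S by fact
  define V where "V = {\<Sum>i<d. s i * x i | s. \<forall>i<d. s i \<in> S}"
  have V0: "0 \<in> V"
    unfolding V_def by (auto intro!: exI[of _ "\<lambda>_. 0"] S.zero)
  have Vadd: "u + v \<in> V" if "u \<in> V" "v \<in> V" for u v
  proof -
    obtain s t where "u = (\<Sum>i<d. s i * x i)" "v = (\<Sum>i<d. t i * x i)"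
      "\<forall>i<d. s i \<in> S" "\<forall>i<d. t i \<in> S" using \<open>u \<in> V\<close> \<open>v \<in> V\<close> by (auto simp: V_def)
    then show ?thesis unfolding V_def
      by (auto intro!: exI[of _ "\<lambda>i. s i + t i"] S.add simp: sum.distrib algebra_simps)
  qed
  have Vmult: "a * v \<in> V" if "a \<in> S" "v \<in> V" for a v
  proof -
    obtain t where "v = (\<Sum>i<d. t i * x i)" "\<forall>i<d. t i \<in> S" using \<open>v \<in> V\<close> by (auto simp: V_def)
    then show ?thesis unfolding V_def using \<open>a \<in> S\<close>
      by (auto intro!: exI[of _ "\<lambda>i. a * t i"] S.mult simp: sum_distrib_left algebra_simps)
  qed
  have Vsum: "(\<And>i. i \<in> I \<Longrightarrow> f i \<in> V) \<Longrightarrow> Groups_Big.sum f I \<in> V" for I :: "nat set" and f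
    by (induction I rule: infinite_finite_induct) (auto intro: V0 Vadd)
  have "finite (h ` V)"
  proof (rule finite_subset)
    \<comment> \<open>\<open>?inv\<close> picks a representative in \<open>S\<close> of each class,
      so every class met by \<open>V\<close> comes from one of finitely many \<open>d\<close>-tuples
      of classes.\<close>
    let ?inv = "\<lambda>b. SOME s. s \<in> S \<and> h s = b"
    let ?\<phi> = "\<lambda>u. h (\<Sum>i<d. ?inv (u i) * x i)"
    show "h ` V \<subseteq> ?\<phi> ` PiE {..<d} (\<lambda>_. h ` S)"
    proof
      fix b assume "b \<in> h ` V"
      then obtain s where s: "b = h (\<Sum>i<d. s i * x i)" "\<forall>i<d. s i \<in> S" by (auto simp: V_def)
      have "?inv (h (s i)) \<in> S \<and> h (?inv (h (s i))) = h (s i)" if "i < d" for i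
        using someI[of "\<lambda>t. t \<in> S \<and> h t = h (s i)" "s i"] s(2) that by auto
      then have "b = ?\<phi> (restrict (\<lambda>i. h (s i)) {..<d})"
        unfolding s(1) by (intro sum mult refl) auto
      moreover have "restrict (\<lambda>i. h (s i)) {..<d} \<in> PiE {..<d} (\<lambda>_. h ` S)"
        using s(2) by auto
      ultimately show "b \<in> ?\<phi> ` PiE {..<d} (\<lambda>_. h ` S)" by blast
    qed
    show "finite (?\<phi> ` PiE {..<d} (\<lambda>_. h ` S))"
      by (rule finite_imageI, rule finite_PiE) (use fin in auto)
  qed
  moreover have "h (x k) \<in> h ` V" for k
  proof (induction k rule: less_induct)
    case (less k)
    show ?case
    proof (cases "k < d")
      case True
      then have "x k = (\<Sum>i<d. (if i = k then 1 else 0) * x i)"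
        by (simp add: if_distrib[of "\<lambda>z. z * _"] cong: if_cong)
      then have "x k \<in> V" unfolding V_def using S.one S.zero by fastforce
      then show ?thesis by simp
    next
      case False
      define k' where "k' = k - d"
      have k: "k = k' + d" using False by (simp add: k'_def)
      \<comment> \<open>Earlier values lie in \<open>V\<close> only up to congruence, so elements
        \<open>v i\<close> of \<open>V\<close> stand in for them.\<close>
      have "\<exists>v. v \<in> V \<and> h (x (k' + i)) = h v" if "i < d" for i
        using less[of "k' + i"] that k by auto
      then obtain v where v: "\<And>i. i < d \<Longrightarrow> v i \<in> V \<and> h (x (k' + i)) = h (v i)" by metis
      have "h (x k) = h (\<Sum>i<d. c i * v i)"
        unfolding k rec by (intro sum mult refl) (use v in auto)
      moreover have "(\<Sum>i<d. c i * v i) \<in> V" by (intro Vsum Vmult c) (use v in auto)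
      ultimately show ?thesis by blast
    qed
  qed
  ultimately show ?thesis using that V0 Vadd Vmult by blast
qed

text \<open>As \<open>f\<close> is monic, \<open>c^k f(c)\<close> being congruent to
  \<open>0\<close> is a recurrence for the powers of \<open>c\<close>. Hence \<open>T = S[c]\<close>
  lies, up to congruence, in the set \<open>V\<close> of \<open>recurrence_values\<close>.\<close>

lemma subring_adjoin:
  assumes "unital_subring S" and fin: "finite (h ` S)"
    and f: "lead_coeff f = 1" "\<And>i. coeff f i \<in> S" "h (poly f c) = h 0"
  obtains T where "unital_subring T" "S \<subseteq> T" "c \<in> T" "finite (h ` T)"
proof -
  interpret S: unital_subring S by fact
  let ?d = "degree f"
  have rec: "h (c ^ (k + ?d)) = h (\<Sum>i<?d. - coeff f i * c ^ (k + i))" for k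
  proof -
    have "c ^ (k + ?d) - (\<Sum>i<?d. - coeff f i * c ^ (k + i)) = c ^ k * poly f c"
      using f(1) by (simp add: poly_altdef lessThan_Suc_atMost[symmetric] power_add sum_distrib_left
          sum_negf algebra_simps)
    then have "h (c ^ (k + ?d) - (\<Sum>i<?d. - coeff f i * c ^ (k + i))) = h 0"
      using mult[OF refl f(3), of "c ^ k"] by simp
    then show ?thesis by (simp only: eq_iff_diff[symmetric])
  qed
  obtain V where V: "finite (h ` V)" "0 \<in> V" "\<And>u v. u \<in> V \<Longrightarrow> v \<in> V \<Longrightarrow> u + v \<in> V"
    "\<And>s v. s \<in> S \<Longrightarrow> v \<in> V \<Longrightarrow> s * v \<in> V" "\<And>k. h (c ^ k) \<in> h ` V"
    by (rule recurrence_values[where x = "\<lambda>k. c ^ k", OF assms(1) fin S.uminus[OF f(2)] rec]) (rule that)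
  have Vsum: "(\<And>i. i \<in> I \<Longrightarrow> g i \<in> V) \<Longrightarrow> Groups_Big.sum g I \<in> V" for I :: "nat set" and g
    by (induction I rule: infinite_finite_induct) (auto intro: V)
  define T where "T = {poly p c | p. \<forall>i. coeff p i \<in> S}"
  have "h ` T \<subseteq> h ` V"
  proof
    fix b assume "b \<in> h ` T"
    then obtain p where p: "b = h (poly p c)" "\<And>i. coeff p i \<in> S" by (auto simp: T_def)
    obtain v where v: "\<And>k. v k \<in> V" "\<And>k. h (c ^ k) = h (v k)"
      using V(5) unfolding image_iff by metis
    have "b = h (\<Sum>i\<le>degree p. coeff p i * v i)"
      unfolding p poly_altdef by (intro sum mult refl v)
    moreover have "(\<Sum>i\<le>degree p. coeff p i * v i) \<in> V" by (intro Vsum V(4) p v)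
    ultimately show "b \<in> h ` V" by blast
  qed
  then have "finite (h ` T)" using V(1) finite_subset by blast
  moreover have "S \<subseteq> T"
  proof
    fix s assume "s \<in> S"
    then show "s \<in> T" unfolding T_def
      by (auto intro!: exI[of _ "[:s:]"] S.zero simp: coeff_pCons split: nat.splits)
  qed
  moreover have "c \<in> T" unfolding T_def
    by (auto intro!: exI[of _ "[:0, 1:]"] S.zero S.one simp: coeff_pCons split: nat.splits)
  ultimately show ?thesis using that S.evaluations[of c] unfolding T_def by blast
qed

text \<open>The residue \<open>of_nat d * y\<close> allows one prime at a time to be treated, where
  Frobenius is available; residues multiply along with the polynomials. Once \<open>d\<close> is
  congruent to \<open>0\<close>, this is integrality over the integers up to congruence.\<close>

definition integral_modulo :: "nat \<Rightarrow> 'a \<Rightarrow> bool" where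
  "integral_modulo d c \<longleftrightarrow>
    (\<exists>f y. lead_coeff f = 1 \<and> (\<forall>i. coeff f i \<in> \<int>) \<and> h (poly f c) = h (of_nat d * y))"

lemma integral_modulo_mult:
  assumes "integral_modulo d c" "integral_modulo e c"
  shows "integral_modulo (d * e) c"
proof -
  obtain f y g z where fg: "lead_coeff f = 1" "\<And>i. coeff f i \<in> \<int>" "h (poly f c) = h (of_nat d * y)"
    "lead_coeff g = 1" "\<And>i. coeff g i \<in> \<int>" "h (poly g c) = h (of_nat e * z)"
    using assms unfolding integral_modulo_def by blast
  have "h (poly (f * g) c) = h (of_nat (d * e) * (y * z))"
    using mult[OF fg(3,6)] by (simp add: algebra_simps)
  moreover have "coeff (f * g) i \<in> \<int>" for i
    using unital_subring.coeff_mult[OF unital_subring_Ints] fg by blast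
  ultimately show ?thesis
    using monic_mult_comm_ring[OF fg(1,4)] unfolding integral_modulo_def by blast
qed

text \<open>By pigeonhole on the exponents \<open>p^i\<close>, two such powers of \<open>A\<close>
  are congruent and so have congruent characteristic polynomials.\<close>

lemma integral_modulo_prime_char_poly_coeff:
  assumes p: "prime p" and A: "A \<in> carrier_mat n n"
    and fin: "finite (range (\<lambda>k. map_mat h (A ^\<^sub>m k)))"
  shows "integral_modulo p (coeff (char_poly A) r)"
proof -
  let ?c = "coeff (char_poly A) r"
  let ?a = "\<lambda>i. coeff (char_poly (A ^\<^sub>m (p ^ i))) r"
  have "finite (range (\<lambda>i. map_mat h (A ^\<^sub>m (p ^ i))))"
    by (rule finite_subset[OF _ fin]) auto
  then have "\<not> inj (\<lambda>i::nat. map_mat h (A ^\<^sub>m (p ^ i)))"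
    using finite_imageD infinite_UNIV_nat by blast
  then obtain i j where ij: "i < j" "map_mat h (A ^\<^sub>m (p ^ i)) = map_mat h (A ^\<^sub>m (p ^ j))"
    unfolding inj_def by (metis linorder_neqE_nat)
  have a: "h (?a j) = h (?a i)"
    using char_poly[OF pow_carrier_mat[OF A] pow_carrier_mat[OF A] ij(2)] by simp
  obtain yi where yi: "?a i - ?c ^ (p ^ i) = of_nat p * yi"
    using prime_dvd_coeff_char_poly_pow_power[OF p A] by (auto simp: dvd_def)
  obtain yj where yj: "?a j - ?c ^ (p ^ j) = of_nat p * yj"
    using prime_dvd_coeff_char_poly_pow_power[OF p A] by (auto simp: dvd_def)
  \<comment> \<open>The powers of \<open>?c\<close> with exponents \<open>p^j\<close> and
    \<open>p^i\<close> differ from the congruent elements \<open>?a j\<close> and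
    \<open>?a i\<close> by multiples of \<open>p\<close>; \<open>i < j\<close> makes
    \<open>f\<close> monic.\<close>
  define f :: "'a poly" where "f = Polynomial.monom 1 (p ^ j) - Polynomial.monom 1 (p ^ i)"
  have less: "p ^ i < p ^ j" using ij p by (intro power_strict_increasing) (auto simp: prime_gt_Suc_0_nat)
  have "degree f = p ^ j"
  proof (rule antisym)
    show "degree f \<le> p ^ j" unfolding f_def
      using less by (intro degree_diff_le order.trans[OF degree_monom_le]) auto
    show "p ^ j \<le> degree f" using less by (intro le_degree) (simp add: f_def)
  qed
  then have "lead_coeff f = 1" using less by (simp add: f_def)
  moreover have "coeff f l \<in> \<int>" for l by (simp add: f_def)
  moreover have "h (poly f ?c) = h (of_nat p * (yi - yj))"
  proof -
    have "poly f ?c = (?a j - ?a i) + of_nat p * (yi - yj)"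
      using yi yj by (simp add: f_def poly_monom algebra_simps)
    also have "h \<dots> = h (0 + of_nat p * (yi - yj))"
      using a by (intro add refl) (simp add: eq_iff_diff[of "?a j"])
    finally show ?thesis by simp
  qed
  ultimately show ?thesis unfolding integral_modulo_def by blast
qed

lemma integral_modulo_char_poly_coeff:
  assumes A: "A \<in> carrier_mat n n"
    and fin: "finite (range (\<lambda>k. map_mat h (A ^\<^sub>m k)))" and "d > 0"
  shows "integral_modulo d (coeff (char_poly A) r)"
  using \<open>d > 0\<close>
proof (induction d rule: prime_divisors_induct)
  case (unit d)
  \<comment> \<open>For \<open>d = 1\<close> the constant polynomial \<open>1\<close> serves, since
    every element is a multiple of \<open>1\<close>.\<close>
  have "h (poly 1 (coeff (char_poly A) r)) = h (of_nat 1 * 1)" by simp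
  moreover have "coeff (1 :: 'a poly) i \<in> \<int>" for i by simp
  ultimately show ?case using unit unfolding integral_modulo_def
    by (metis lead_coeff_1 nat_dvd_1_iff_1)
next
  case (factor p d)
  then show ?case
    using integral_modulo_mult integral_modulo_prime_char_poly_coeff[OF _ A fin] by simp
qed simp

lemma finite_image_Ints:
  assumes "m > 0" "h (of_nat m) = h 0"
  shows "finite (h ` \<int>)"
proof (rule finite_subset)
  show "h ` \<int> \<subseteq> (\<lambda>z. h (of_int z)) ` {0..<int m}"
  proof
    fix b assume "b \<in> h ` \<int>"
    then obtain z where z: "b = h (of_int z)" by (auto elim: Ints_cases)
    have "of_int z = (of_int (z mod int m) + of_nat m * of_int (z div int m) :: 'a)"
      by (metis mod_mult_div_eq of_int_add of_int_mult of_int_of_nat_eq)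
    then have "b = h (of_int (z mod int m) + 0 * of_int (z div int m))"
      unfolding z by (simp only:) (intro add mult refl assms(2))
    then show "b \<in> (\<lambda>z. h (of_int z)) ` {0..<int m}" using assms(1) by simp
  qed
qed simp

text \<open>The elements are adjoined one at a time, starting from the integers. Keeping the
  integers inside \<open>S\<close> ensures that the polynomial of the next element has coefficients
  in \<open>S\<close>.\<close>

lemma finite_integral_subset:
  assumes m: "m > 0" "h (of_nat m) = h 0"
    and "finite C" "\<And>c. c \<in> C \<Longrightarrow> integral_modulo m c"
  shows "\<exists>S. unital_subring S \<and> C \<subseteq> S \<and> \<int> \<subseteq> S \<and> finite (h ` S)"
  using assms(3,4)
proof (induction C rule: finite_induct)
  case empty
  then show ?case using unital_subring_Ints finite_image_Ints[OF m] by blast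
next
  case (insert c C)
  then obtain S where S: "unital_subring S" "C \<subseteq> S" "\<int> \<subseteq> S" "finite (h ` S)" by auto
  obtain f y where f: "lead_coeff f = 1" "\<And>i. coeff f i \<in> \<int>" "h (poly f c) = h (of_nat m * y)"
    using insert.prems[of c] unfolding integral_modulo_def by blast
  \<comment> \<open>The residue disappears because \<open>m\<close> is congruent to
    \<open>0\<close>.\<close>
  have "h (of_nat m * y) = h 0" using mult[OF m(2) refl, of y] by simp
  then have "h (poly f c) = h 0" using f(3) by simp
  moreover have "coeff f i \<in> S" for i using f(2) S(3) by blast
  ultimately obtain T where "unital_subring T" "S \<subseteq> T" "c \<in> T" "finite (h ` T)"
    using subring_adjoin[OF S(1,4) f(1)] by blast
  then show ?case using S by (intro exI[of _ T]) auto
qed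

text \<open>Finiteness and equality are taken up to \<open>h\<close> because in the application
  \<open>A\<close> and \<open>B\<close> are lifts to a free ring, where their characteristic
  polynomials need not agree.\<close>

lemma finite_powers_transfer:
  assumes m: "m > 0" "h (of_nat m) = h 0"
    and A: "A \<in> carrier_mat n n" and B: "B \<in> carrier_mat n n"
    and char_poly_eq: "\<And>r. h (coeff (char_poly A) r) = h (coeff (char_poly B) r)"
    and fin: "finite (range (\<lambda>k. map_mat h (A ^\<^sub>m k)))"
  shows "finite (range (\<lambda>k. map_mat h (B ^\<^sub>m k)))"
proof -
  obtain S where S: "unital_subring S" "coeff (char_poly A) ` {..<n} \<subseteq> S" "finite (h ` S)"
    using finite_integral_subset[OF m, of "coeff (char_poly A) ` {..<n}"]
      integral_modulo_char_poly_coeff[OF A fin m(1)] by blast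
  interpret S: unital_subring S by fact
  have finite_entry: "finite (range (\<lambda>k. h ((B ^\<^sub>m k) $$ (i, j))))" if ij: "i < n" "j < n" for i j
  proof -
    \<comment> \<open>Monicity isolates the top term in Cayley--Hamilton for \<open>B\<close>; the
      other coefficients are then exchanged for the congruent ones of \<open>A\<close>, which are
      known to lie in \<open>S\<close>.\<close>
    have rec: "h ((B ^\<^sub>m (k + n)) $$ (i, j)) =
        h (\<Sum>r<n. - coeff (char_poly A) r * (B ^\<^sub>m (k + r)) $$ (i, j))" for k
    proof -
      have "(B ^\<^sub>m (k + n)) $$ (i, j) = (\<Sum>r<n. - coeff (char_poly B) r * (B ^\<^sub>m (k + r)) $$ (i, j))"
        using cayley_hamilton_entry[OF B ij, of k] degree_monic_char_poly[OF B]
        by (simp add: lessThan_Suc_atMost[symmetric] sum_negf eq_neg_iff_add_eq_0 add.commute)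
      also have "h \<dots> = h (\<Sum>r<n. - coeff (char_poly A) r * (B ^\<^sub>m (k + r)) $$ (i, j))"
        by (intro sum mult uminus refl char_poly_eq[symmetric])
      finally show ?thesis .
    qed
    have coeffs: "- coeff (char_poly A) r \<in> S" if "r < n" for r
      using that S(2) by (intro S.uminus) auto
    obtain V where "finite (h ` V)" "\<And>k. h ((B ^\<^sub>m k) $$ (i, j)) \<in> h ` V"
      by (rule recurrence_values[where x = "\<lambda>k. (B ^\<^sub>m k) $$ (i, j)", OF S(1,3) coeffs rec]) (assumption, rule that)
    then show ?thesis by (meson finite_subset image_subsetI)
  qed
  let ?E = "\<lambda>ij. range (\<lambda>k. h ((B ^\<^sub>m k) $$ ij))"
  show ?thesis
  proof (rule finite_subset)
    show "range (\<lambda>k. map_mat h (B ^\<^sub>m k)) \<subseteq> mat n n ` PiE ({..<n} \<times> {..<n}) ?E"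
    proof
      fix M assume "M \<in> range (\<lambda>k. map_mat h (B ^\<^sub>m k))"
      then obtain k where "M = map_mat h (B ^\<^sub>m k)" by blast
      then have "M = mat n n (restrict (\<lambda>ij. h ((B ^\<^sub>m k) $$ ij)) ({..<n} \<times> {..<n}))"
        using B by (intro eq_matI) auto
      then show "M \<in> mat n n ` PiE ({..<n} \<times> {..<n}) ?E" by auto
    qed
    show "finite (mat n n ` PiE ({..<n} \<times> {..<n}) ?E)"
      by (rule finite_imageI, rule finite_PiE) (auto intro: finite_entry)
  qed
qed

end

section \<open>Homomorphisms from a type-class ring onto a locale ring\<close>

locale ring_evaluation = cring R for R (structure) +
  fixes h :: "'b::comm_ring_1 \<Rightarrow> 'a"
  assumes hom_closed: "h x \<in> carrier R"
    and hom_add: "h (x + y) = h x \<oplus> h y"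
    and hom_mult: "h (x * y) = h x \<otimes> h y"
    and hom_one: "h 1 = \<one>"
begin

lemma ring_congruence: "ring_congruence h"
  by unfold_locales (simp_all add: hom_add hom_mult)

lemma hom_zero: "h 0 = \<zero>"
proof -
  have "h 0 \<oplus> h 0 = h 0" using hom_add[of 0 0] by simp
  then show ?thesis using hom_closed by (metis add.l_cancel_one)
qed

lemma hom_uminus: "h (- x) = \<ominus> h x"
proof -
  have "h (- x) \<oplus> h x = \<zero>" using hom_add[of "- x" x] by (simp add: hom_zero)
  then show ?thesis using hom_closed by (metis minus_equality)
qed

lemma hom_diff: "h (x - y) = h x \<ominus> h y"
  using hom_add[of x "- y"] by (simp add: hom_uminus a_minus_def)

lemma hom_sum: "h (\<Sum>i\<in>I. f i) = (\<Oplus>i\<in>I. h (f i))"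
  by (induction I rule: infinite_finite_induct) (auto simp: hom_zero hom_add hom_closed)

lemma hom_prod: "h (\<Prod>i\<in>I. f i) = (\<Otimes>i\<in>I. h (f i))"
  by (induction I rule: infinite_finite_induct) (auto simp: hom_one hom_mult hom_closed)

lemma hom_of_nat: "h (of_nat k) = [k] \<cdot> \<one>"
  by (induction k) (auto simp: hom_zero hom_add hom_one hom_closed add.m_comm)

lemma determinant_map_mat:
  assumes "A \<in> carrier_mat n n"
  shows "determinant R n (map_mat h A) = h (det A)"
proof -
  have "h (det A) = (\<Oplus>p\<in>{p. p permutes {0..<n}}.
      h (signof p) \<otimes> (\<Otimes>i\<in>{0..<n}. h (A $$ (i, p i))))"
    unfolding det_def'[OF assms] by (simp add: hom_sum hom_mult hom_prod)
  also have "\<dots> = determinant R n (map_mat h A)"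
    unfolding determinant_def lessThan_atLeast0
  proof (intro add.finprod_cong' refl)
    fix p assume "p \<in> {p. p permutes {0..<n}}"
    then have "map_mat h A $$ (i, p i) = h (A $$ (i, p i))" if "i < n" for i
      using assms that permutes_in_image[of p "{0..<n}" i] by simp
    then have "(\<Otimes>i\<in>{0..<n}. h (A $$ (i, p i))) = (\<Otimes>i\<in>{0..<n}. map_mat h A $$ (i, p i))"
      by (intro finprod_cong') (auto simp: hom_closed)
    moreover have "h (signof p) = (if evenperm p then \<one> else \<ominus> \<one>)"
      by (simp add: sign_def hom_one hom_uminus)
    ultimately show "h (signof p) \<otimes> (\<Otimes>i\<in>{0..<n}. h (A $$ (i, p i))) =
        (if evenperm p then \<one> else \<ominus> \<one>) \<otimes> (\<Otimes>i\<in>{0..<n}. map_mat h A $$ (i, p i))"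
      by simp
  next
    have "map_mat h A $$ (i, p i) \<in> carrier R" if "p permutes {0..<n}" "i < n" for p i
      using assms that permutes_in_image[of p "{0..<n}" i] by (simp add: hom_closed)
    then show "(\<lambda>p. (if evenperm p then \<one> else \<ominus> \<one>) \<otimes> (\<Otimes>i\<in>{0..<n}. map_mat h A $$ (i, p i)))
        \<in> {p. p permutes {0..<n}} \<rightarrow> carrier R"
      by (auto intro!: finprod_closed)
  qed
  finally show ?thesis by simp
qed

text \<open>This makes \<open>determinant_map_mat\<close> applicable with \<open>UP R\<close> in
  place of \<open>R\<close>, as the characteristic polynomial requires.\<close>

lemma ring_evaluation_UP: "ring_evaluation (UP R) (\<lambda>p k. h (coeff p k))"
proof -
  have up: "(\<lambda>k. h (coeff p k)) \<in> up R" for p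
    by (auto simp: hom_closed hom_zero coeff_eq_0 bound_def intro!: mem_upI exI[of _ "degree p"])
  interpret UP: UP_cring R "UP R" by unfold_locales simp
  show ?thesis
  proof unfold_locales
    show "(\<lambda>k. h (coeff p k)) \<in> carrier (UP R)" for p
      using up by (simp add: UP_def)
    show "(\<lambda>k. h (coeff (p + q) k)) = (\<lambda>k. h (coeff p k)) \<oplus>\<^bsub>UP R\<^esub> (\<lambda>k. h (coeff q k))" for p q
      using up by (simp add: UP_def hom_add)
    show "(\<lambda>k. h (coeff (p * q) k)) = (\<lambda>k. h (coeff p k)) \<otimes>\<^bsub>UP R\<^esub> (\<lambda>k. h (coeff q k))" for p q
      using up by (simp add: UP_def hom_mult hom_sum coeff_mult)
    show "(\<lambda>k. h (coeff 1 k)) = \<one>\<^bsub>UP R\<^esub>"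
      by (auto simp: UP_def hom_one hom_zero)
  qed
qed

lemma characteristic_poly_map_mat:
  assumes A: "A \<in> carrier_mat n n"
  shows "characteristic_poly R n (map_mat h A) = (\<lambda>k. h (coeff (char_poly A) k))"
proof -
  interpret P: ring_evaluation "UP R" "\<lambda>p k. h (coeff p k)" by (rule ring_evaluation_UP)
  have "mat n n (\<lambda>(i, j). (if i = j then up_ring.monom (UP R) \<one> 1 else \<zero>\<^bsub>UP R\<^esub>)
          \<ominus>\<^bsub>UP R\<^esub> up_ring.monom (UP R) (map_mat h A $$ (i, j)) 0) =
        map_mat (\<lambda>p k. h (coeff p k)) (char_poly_matrix A)"
  proof (rule eq_matI)
    fix i j assume "i < dim_row (map_mat (\<lambda>p k. h (coeff p k)) (char_poly_matrix A))"
      "j < dim_col (map_mat (\<lambda>p k. h (coeff p k)) (char_poly_matrix A))"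
    then have ij: "i < n" "j < n" using char_poly_matrix_closed[OF A] by auto
    have t: "up_ring.monom (UP R) \<one> 1 = (\<lambda>k. h (coeff [:0, 1:] k))"
      by (auto simp: UP_def hom_zero hom_one fun_eq_iff coeff_pCons split: nat.splits)
    have c: "up_ring.monom (UP R) (h a) 0 = (\<lambda>k. h (coeff [:a:] k))" for a
      by (auto simp: UP_def hom_zero hom_closed fun_eq_iff coeff_pCons split: nat.splits)
    have z: "\<zero>\<^bsub>UP R\<^esub> = (\<lambda>k. h (coeff 0 k))" using P.hom_zero by simp
    show "mat n n (\<lambda>(i, j). (if i = j then up_ring.monom (UP R) \<one> 1 else \<zero>\<^bsub>UP R\<^esub>)
          \<ominus>\<^bsub>UP R\<^esub> up_ring.monom (UP R) (map_mat h A $$ (i, j)) 0) $$ (i, j) =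
        map_mat (\<lambda>p k. h (coeff p k)) (char_poly_matrix A) $$ (i, j)"
      using ij A char_poly_matrix_closed[OF A]
      by (cases "i = j") (simp_all only: index_mat index_map_mat carrier_matD split t c z
          P.hom_diff[symmetric] index_char_poly_matrix refl if_True if_False)
  qed (use char_poly_matrix_closed[OF A] in auto)
  then show ?thesis
    unfolding characteristic_poly_def char_poly_def
    using P.determinant_map_mat[OF char_poly_matrix_closed[OF A]] by simp
qed

lemma matrix_ring_pow_map_mat:
  assumes A: "A \<in> carrier_mat n n"
  shows "map_mat h A [^]\<^bsub>matrix_ring R n\<^esub> k = map_mat h (A ^\<^sub>m k)"
proof (induction k)
  case 0
  show ?case using A
    by (intro eq_matI) (auto simp: matrix_ring_def nat_pow_def hom_one hom_zero)
next
  case (Suc k)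
  have "map_mat h A [^]\<^bsub>matrix_ring R n\<^esub> Suc k =
     map_mat h (A ^\<^sub>m k) \<otimes>\<^bsub>matrix_ring R n\<^esub> map_mat h A"
    using Suc by (simp add: nat_pow_def)
  also have "\<dots> = map_mat h (A ^\<^sub>m k * A)"
  proof (rule eq_matI)
    fix i j assume "i < dim_row (map_mat h (A ^\<^sub>m k * A))" "j < dim_col (map_mat h (A ^\<^sub>m k * A))"
    then have ij: "i < n" "j < n" using A by auto
    then have "map_mat h (A ^\<^sub>m k * A) $$ (i, j) = h (\<Sum>l<n. (A ^\<^sub>m k) $$ (i, l) * A $$ (l, j))"
      using A index_mult_mat_sum[of "A ^\<^sub>m k" n A i j] by (simp del: index_mult_mat(1))
    also have "\<dots> = (\<Oplus>l\<in>{..<n}. map_mat h (A ^\<^sub>m k) $$ (i, l) \<otimes> map_mat h A $$ (l, j))"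
      unfolding hom_sum using A ij
      by (intro add.finprod_cong') (auto simp: hom_mult hom_closed)
    finally show "(map_mat h (A ^\<^sub>m k) \<otimes>\<^bsub>matrix_ring R n\<^esub> map_mat h A) $$ (i, j) =
        map_mat h (A ^\<^sub>m k * A) $$ (i, j)"
      using ij by (simp add: matrix_ring_def)
  qed (use A in \<open>auto simp: matrix_ring_def\<close>)
  finally show ?case by simp
qed

end

section \<open>The free commutative ring\<close>

lemma poly_mapping_additive_induct:
  fixes f :: "'k \<Rightarrow>\<^sub>0 'v::comm_monoid_add"
  assumes "P 0" "\<And>k a. P (Poly_Mapping.single k a)" "\<And>f g. P f \<Longrightarrow> P g \<Longrightarrow> P (f + g)"
  shows "P f"
proof -
  have "P (\<Sum>k\<in>K. Poly_Mapping.single k (Poly_Mapping.lookup f k))" for K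
    by (induction K rule: infinite_finite_induct) (auto intro: assms)
  moreover have "f = (\<Sum>k\<in>Poly_Mapping.keys f. Poly_Mapping.single k (Poly_Mapping.lookup f k))"
    by (rule poly_mapping_eqI)
       (auto simp: lookup_sum lookup_single when_def in_keys_iff)
  ultimately show ?thesis by metis
qed

text \<open>The free commutative ring on the elements of \<open>R\<close>, with integer coefficients, is an instance of the
  class \<open>comm_ring_1\<close>; its evaluation map onto \<open>R\<close> makes the class-based determinants available
  for \<open>R\<close>. Generators outside the carrier are sent to \<open>\<zero>\<close>.\<close>

context cring
begin

definition power_product :: "('a \<Rightarrow>\<^sub>0 nat) \<Rightarrow> 'a" where
  "power_product k = (\<Otimes>a\<in>Poly_Mapping.keys k. (if a \<in> carrier R then a else \<zero>) [^] Poly_Mapping.lookup k a)"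

definition evaluate :: "(('a \<Rightarrow>\<^sub>0 nat) \<Rightarrow>\<^sub>0 int) \<Rightarrow> 'a" where
  "evaluate f = (\<Oplus>k\<in>Poly_Mapping.keys f. [Poly_Mapping.lookup f k] \<cdot> power_product k)"

text \<open>Exponent vectors may have different supports; over a common finite index set their
  products are compared factor by factor. \<open>evaluate_superset\<close> does the same for
  sums.\<close>

lemma power_product_superset:
  assumes "finite U" "Poly_Mapping.keys k \<subseteq> U"
  shows "power_product k = (\<Otimes>a\<in>U. (if a \<in> carrier R then a else \<zero>) [^] Poly_Mapping.lookup k a)"
  unfolding power_product_def using assms
  by (intro finprod_mono_neutral_cong_left) (auto simp: in_keys_iff)

lemma power_product_closed: "power_product k \<in> carrier R"
  unfolding power_product_def by (intro finprod_closed) auto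

lemma power_product_add: "power_product (k + l) = power_product k \<otimes> power_product l"
proof -
  let ?U = "Poly_Mapping.keys k \<union> Poly_Mapping.keys l"
  have "power_product (k + l) = (\<Otimes>a\<in>?U. (if a \<in> carrier R then a else \<zero>) [^] Poly_Mapping.lookup (k + l) a)"
    by (intro power_product_superset keys_add) auto
  also have "\<dots> = (\<Otimes>a\<in>?U. (if a \<in> carrier R then a else \<zero>) [^] Poly_Mapping.lookup k a \<otimes>
      (if a \<in> carrier R then a else \<zero>) [^] Poly_Mapping.lookup l a)"
    by (intro finprod_cong') (auto simp: lookup_add nat_pow_mult)
  also have "\<dots> = power_product k \<otimes> power_product l"
    by (subst finprod_multf) (auto simp: power_product_superset[of ?U])
  finally show ?thesis .
qed

lemma evaluate_superset:
  assumes "finite U" "Poly_Mapping.keys f \<subseteq> U"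
  shows "evaluate f = (\<Oplus>k\<in>U. [Poly_Mapping.lookup f k] \<cdot> power_product k)"
  unfolding evaluate_def using assms
  by (intro add.finprod_mono_neutral_cong_left) (auto simp: in_keys_iff power_product_closed add_pow_int_ge)

lemma evaluate_closed: "evaluate f \<in> carrier R"
  unfolding evaluate_def by (intro finsum_closed) (auto simp: power_product_closed)

lemma evaluate_add: "evaluate (f + g) = evaluate f \<oplus> evaluate g"
proof -
  let ?U = "Poly_Mapping.keys f \<union> Poly_Mapping.keys g"
  have "evaluate (f + g) = (\<Oplus>k\<in>?U. [Poly_Mapping.lookup (f + g) k] \<cdot> power_product k)"
    by (intro evaluate_superset keys_add) auto
  also have "\<dots> = (\<Oplus>k\<in>?U. [Poly_Mapping.lookup f k] \<cdot> power_product k \<oplus> [Poly_Mapping.lookup g k] \<cdot> power_product k)"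
    by (intro add.finprod_cong') (auto simp: lookup_add add.int_pow_mult power_product_closed)
  also have "\<dots> = evaluate f \<oplus> evaluate g"
    by (subst finsum_addf) (auto simp: evaluate_superset[of ?U] power_product_closed)
  finally show ?thesis .
qed

lemma evaluate_single: "evaluate (Poly_Mapping.single k a) = [a] \<cdot> power_product k"
  by (subst evaluate_superset[of "{k}"]) (auto simp: power_product_closed)

lemma evaluate_zero: "evaluate 0 = \<zero>"
  by (simp add: evaluate_def)

text \<open>Both sides are additive in each argument, which reduces the claim to single terms and
  hence to \<open>power_product_add\<close>.\<close>

lemma evaluate_mult: "evaluate (f * g) = evaluate f \<otimes> evaluate g"
proof (induction f rule: poly_mapping_additive_induct)
  case 1
  show ?case by (simp add: evaluate_zero evaluate_closed)
next
  case (2 k a)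
  show ?case
  proof (induction g rule: poly_mapping_additive_induct)
    case 1
    show ?case by (simp add: evaluate_zero evaluate_closed)
  next
    case (2 l b)
    have "[a] \<cdot> power_product k \<otimes> [b] \<cdot> power_product l =
        [b] \<cdot> ([a] \<cdot> (power_product k \<otimes> power_product l))"
      by (simp add: add_pow_ldistr_int add_pow_rdistr_int power_product_closed)
    also have "\<dots> = [(a * b)] \<cdot> (power_product k \<otimes> power_product l)"
      by (simp add: add.int_pow_pow power_product_closed mult.commute)
    finally show ?case by (simp add: mult_single evaluate_single power_product_add)
  next
    case (3 f g)
    then show ?case by (simp add: distrib_left evaluate_add r_distr evaluate_closed)
  qed
next
  case (3 f1 f2)
  then show ?case by (simp add: distrib_right evaluate_add l_distr evaluate_closed)
qed

lemma ring_evaluation_evaluate: "ring_evaluation R evaluate"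
proof unfold_locales
  show "evaluate 1 = \<one>"
    unfolding single_one[symmetric] by (simp add: evaluate_single power_product_def add_pow_int_ge del: single_one)
qed (simp_all add: evaluate_closed evaluate_add evaluate_mult)

lemma evaluate_surj:
  assumes "a \<in> carrier R"
  shows "evaluate (Poly_Mapping.single (Poly_Mapping.single a 1) 1) = a"
  using assms by (simp add: evaluate_single power_product_def)

text \<open>Each entry is lifted to the generator it indexes, \<open>finite_powers_transfer\<close>
  is applied in the free ring to the congruence given by \<open>evaluate\<close>, and the result is
  read back in \<open>R\<close>.\<close>

lemma finite_powers_if_characteristic_poly_eq:
  fixes m :: nat
  assumes m: "m > 0" "[m] \<cdot> \<one> = \<zero>"
    and A: "A \<in> carrier (matrix_ring R n)" and B: "B \<in> carrier (matrix_ring R n)"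
    and eq: "characteristic_poly R n A = characteristic_poly R n B"
    and fin: "finite (range (\<lambda>k::nat. A [^]\<^bsub>matrix_ring R n\<^esub> k))"
  shows "finite (range (\<lambda>k::nat. B [^]\<^bsub>matrix_ring R n\<^esub> k))"
proof -
  interpret ring_evaluation R evaluate by (rule ring_evaluation_evaluate)
  let ?lift = "\<lambda>M. map_mat (\<lambda>a. Poly_Mapping.single (Poly_Mapping.single a 1) 1) M
      :: (('a \<Rightarrow>\<^sub>0 nat) \<Rightarrow>\<^sub>0 int) mat"
  have lift: "?lift M \<in> carrier_mat n n" "map_mat evaluate (?lift M) = M"
    if "M \<in> carrier (matrix_ring R n)" for M
  proof -
    have M: "M \<in> carrier_mat n n" "elements_mat M \<subseteq> carrier R"
      using that by (auto simp: matrix_ring_def)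
    then show "?lift M \<in> carrier_mat n n" by simp
    have "M $$ (i, j) \<in> carrier R" if "i < dim_row M" "j < dim_col M" for i j
      using that M by (blast intro: elements_matI)
    then show "map_mat evaluate (?lift M) = M" by (intro eq_matI) (auto simp: evaluate_surj simp del: One_nat_def)
  qed
  have pow: "M [^]\<^bsub>matrix_ring R n\<^esub> k = map_mat evaluate (?lift M ^\<^sub>m k)"
    if "M \<in> carrier (matrix_ring R n)" for M and k :: nat
    using matrix_ring_pow_map_mat[OF lift(1)[OF that], of k] lift(2)[OF that] by simp
  have char: "characteristic_poly R n M r = evaluate (coeff (char_poly (?lift M)) r)"
    if "M \<in> carrier (matrix_ring R n)" for M r
    using characteristic_poly_map_mat[OF lift(1)[OF that]] lift(2)[OF that] by simp
  have "finite (range (\<lambda>k. map_mat evaluate (?lift B ^\<^sub>m k)))"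
  proof (rule ring_congruence.finite_powers_transfer[OF ring_congruence m(1) _ lift(1)[OF A] lift(1)[OF B]])
    show "evaluate (of_nat m) = evaluate 0" using m(2) by (simp only: hom_of_nat hom_zero)
    show "evaluate (coeff (char_poly (?lift A)) r) = evaluate (coeff (char_poly (?lift B)) r)" for r
      using eq char[OF A] char[OF B] by metis
    show "finite (range (\<lambda>k. map_mat evaluate (?lift A ^\<^sub>m k)))"
      using fin unfolding pow[OF A] .
  qed
  then show ?thesis unfolding pow[OF B] .
qed

end

section \<open>Positive characteristic of the algebra and the conclusion\<close>

lemma (in algebra) positive_characteristic:
  assumes "finite (carrier R)"
  obtains m :: nat where "m > 0" "[m] \<cdot>\<^bsub>M\<^esub> \<one>\<^bsub>M\<^esub> = \<zero>\<^bsub>M\<^esub>"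
proof
  let ?m = "card (carrier R)"
  show "?m > 0" using assms R.zero_closed card_gt_0_iff by blast
  \<comment> \<open>Lagrange's theorem in the additive group of the finite ring; the relation is
    then carried to the algebra by scalar action on its unit.\<close>
  have 0: "[?m] \<cdot>\<^bsub>R\<^esub> \<one>\<^bsub>R\<^esub> = \<zero>\<^bsub>R\<^esub>"
    using R.add.power_order_eq_one[OF assms R.one_closed] .
  have "[k] \<cdot>\<^bsub>M\<^esub> \<one>\<^bsub>M\<^esub> = ([k] \<cdot>\<^bsub>R\<^esub> \<one>\<^bsub>R\<^esub>) \<odot>\<^bsub>M\<^esub> \<one>\<^bsub>M\<^esub>" for k :: nat
    by (induction k) (simp_all add: smult_l_distr smult_l_null)
  then show "[?m] \<cdot>\<^bsub>M\<^esub> \<one>\<^bsub>M\<^esub> = \<zero>\<^bsub>M\<^esub>" using 0 by (simp add: smult_l_null)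
qed

theorem theorem1p2:
  fixes K :: "('k, 'c) ring_scheme"
    and L :: "('k, 'l, 'd) module_scheme"
    and n :: nat
    and A B :: "'l mat"
  assumes "algebra K L"
    and "finite (carrier K)"
    and "A \<in> carrier (matrix_ring L n)"
    and "B \<in> carrier (matrix_ring L n)"
    and "characteristic_poly L n A = characteristic_poly L n B"
  shows "finite {A [^]\<^bsub>matrix_ring L n\<^esub> k | k :: nat. True} \<longleftrightarrow>
         finite {B [^]\<^bsub>matrix_ring L n\<^esub> k | k :: nat. True}"
proof -
  interpret algebra K L by fact
  obtain m :: nat where m: "m > 0" "[m] \<cdot>\<^bsub>L\<^esub> \<one>\<^bsub>L\<^esub> = \<zero>\<^bsub>L\<^esub>"
    using positive_characteristic[OF assms(2)] .
  have L: "cring L" by unfold_locales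
  \<comment> \<open>Each implication is the one-sided result, with \<open>A\<close> and
    \<open>B\<close> exchanged for the second.\<close>
  show ?thesis
    unfolding simp_thms full_SetCompr_eq
    using cring.finite_powers_if_characteristic_poly_eq[OF L m assms(3,4,5)]
      cring.finite_powers_if_characteristic_poly_eq[OF L m assms(4,3) assms(5)[symmetric]]
    by blast
qed

end
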